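(* Let $p=p(n)$, $m=\binom n2 p$ and $d=(n-2)p^2$, and suppose $d=\Theta(1)$, i.e. there are constants $0<c\le C$ with $c\le d\le C$ for all sufficiently large $n$. Let $\psi(d)=\frac12\big[1-\exp\big(-\frac d2(1+e^{-d})\big)\big]$. Then for every $\varepsilon>0$, with probability tending to $1$ as $n\to\infty$, \[\tau(G_{n,p})<(1+\varepsilon)\,\psi(d)\,m.\]
   Context: $G_{n,p}$ is the binomial random graph on vertex set $[n]$ in which each of the $\binom n2$ possible edges is present independently with probability $p$. For a finite graph $H$, $\tau(H)$ is the minimum size of a set $F$ of edges of $H$ such that every triangle of $H$ contains an edge of $F$. *)

theory Defs
  imports "HOL-Probability.Probability" "HOL-Probability.Product_PMF"
begin

text \<open>
  A simple graph is represented by its edge set, each edge being a two-element set of vertices.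
  The vertex set plays no role in triangles or in their edge covers.
\<close>

definition potential_edges :: "nat \<Rightarrow> nat set set" where
  "potential_edges n = {e. e \<subseteq> {1..n} \<and> card e = 2}"

definition gnp :: "nat \<Rightarrow> real \<Rightarrow> nat set set pmf" where
  "gnp n p =
     map_pmf (\<lambda>present. {e \<in> potential_edges n. present e})
       (Pi_pmf (potential_edges n) False (\<lambda>_. bernoulli_pmf p))"

text \<open>A triangle is identified with the set of its three edges.\<close>

definition triangles :: "'a set set \<Rightarrow> 'a set set set" where
  "triangles E =
     {{{x, y}, {y, z}, {x, z}} | x y z.
        x \<noteq> y \<and> y \<noteq> z \<and> x \<noteq> z \<and> {x, y} \<in> E \<and> {y, z} \<in> E \<and> {x, z} \<in> E}"

text \<open>
  Intended for finite \<open>E\<close>, where \<open>F = E\<close> is always a candidate, so the minimum exists.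
\<close>

definition triangle_cover_number :: "'a set set \<Rightarrow> nat" where
  "triangle_cover_number E =
     (LEAST k. \<exists>F. F \<subseteq> E \<and> finite F \<and> card F = k \<and> (\<forall>T \<in> triangles E. F \<inter> T \<noteq> {}))"

definition psi :: "real \<Rightarrow> real" where
  "psi d = 1 / 2 * (1 - exp (- (d / 2) * (1 + exp (- d))))"

end

theory Submission
  imports Defs
begin

text \<open>
  Split the vertices into two halves \<open>A\<close> and \<open>B\<close>. Every triangle has one or three edges inside a half.
  Take the edges inside a half that lie in a triangle with apex in the other half, together with all
  three edges of each triangle inside a half none of whose edges was taken. This is a triangle cover.
  A given edge has no apex in the other half with probability about \<open>e\<^bsup>-d/2\<^esup>\<close>, and it lies
  in about \<open>d/2\<close> triangles inside its half; in each of these, both other edges have no such apex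
  with probability about \<open>e\<^bsup>-d\<^esup>\<close>; hence an edge inside a half is taken with probability
  about \<open>2 \<psi>(d)\<close>, and about half of the edges lie inside a half. This bounds the expectation of
  the cover number. The cover number changes by at most 1 when an edge is flipped, so its variance
  is at most \<open>n\<^sup>2\<close>, while \<open>m\<^sup>2\<close> has order \<open>n\<^sup>3\<close>, and Chebyshev's inequality concludes.
\<close>

section \<open>Products of Bernoulli variables\<close>

definition depends_on :: "(('i \<Rightarrow> 'b) \<Rightarrow> 'c) \<Rightarrow> 'i set \<Rightarrow> bool" where
  "depends_on f T \<longleftrightarrow> (\<forall>x y. (\<forall>i\<in>T. x i = y i) \<longrightarrow> f x = f y)"

lemma depends_onI: "(\<And>x y. (\<And>i. i \<in> T \<Longrightarrow> x i = y i) \<Longrightarrow> f x = f y) \<Longrightarrow> depends_on f T"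
  unfolding depends_on_def by blast

lemma depends_onD: "depends_on f T \<Longrightarrow> (\<And>i. i \<in> T \<Longrightarrow> x i = y i) \<Longrightarrow> f x = f y"
  unfolding depends_on_def by blast

lemma expectation_pair_pmf_finite:
  fixes f :: "'a \<times> 'b \<Rightarrow> real"
  assumes "finite (set_pmf p)" "finite (set_pmf q)"
  shows "measure_pmf.expectation (pair_pmf p q) f =
    measure_pmf.expectation p (\<lambda>a. measure_pmf.expectation q (\<lambda>b. f (a, b)))"
proof -
  have "measure_pmf.expectation (pair_pmf p q) f = (\<Sum>z\<in>set_pmf p \<times> set_pmf q. pmf (pair_pmf p q) z * f z)"
    using assms by (subst integral_measure_pmf_real[of "set_pmf p \<times> set_pmf q"]) (auto simp: mult.commute)
  also have "\<dots> = (\<Sum>a\<in>set_pmf p. pmf p a * (\<Sum>b\<in>set_pmf q. pmf q b * f (a, b)))"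
    by (subst sum.cartesian_product')
       (auto simp: pmf_pair sum_distrib_left mult_ac intro!: sum.cong)
  also have "\<dots> = measure_pmf.expectation p (\<lambda>a. measure_pmf.expectation q (\<lambda>b. f (a, b)))"
    using assms
    by (simp add: integral_measure_pmf_real[of "set_pmf p"] integral_measure_pmf_real[of "set_pmf q"]
        mult.commute)
  finally show ?thesis .
qed

lemma prod_of_bool_eq:
  assumes "finite I"
  shows "(\<Prod>i\<in>I. of_bool (Q i)) = (of_bool (\<forall>i\<in>I. Q i) :: real)"
  using assms by (induction rule: finite_induct) auto

locale bernoulli_product =
  fixes V :: "'i set" and p :: real
  assumes finite_V: "finite V" and p_nonneg: "0 \<le> p" and p_le_1: "p \<le> 1"
begin

text \<open>The index set is a parameter instead of \<open>V\<close> because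
  \<open>Ex_decouple\<close> splits \<open>V\<close> into two blocks and
  \<open>Efron_Stein_Lipschitz\<close> adds one coordinate at a time.\<close>

definition coins :: "'i set \<Rightarrow> ('i \<Rightarrow> bool) pmf" where
  "coins W = Pi_pmf W False (\<lambda>_. bernoulli_pmf p)"

abbreviation Ex :: "(('i \<Rightarrow> bool) \<Rightarrow> real) \<Rightarrow> real" where
  "Ex \<equiv> measure_pmf.expectation (coins V)"

lemma finite_set_coins: "finite W \<Longrightarrow> finite (set_pmf (coins W))"
  unfolding coins_def by (subst set_Pi_pmf) (auto intro!: finite_PiE_dflt)

lemma coins_outside: "x \<in> set_pmf (coins W) \<Longrightarrow> finite W \<Longrightarrow> i \<notin> W \<Longrightarrow> \<not> x i"
  unfolding coins_def using set_Pi_pmf_subset by fastforce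

lemma integrable_coins [simp]: "integrable (measure_pmf (coins V)) (f :: _ \<Rightarrow> real)"
  by (intro integrable_measure_pmf_finite finite_set_coins finite_V)

lemma expectation_coins_union:
  fixes f :: "('i \<Rightarrow> bool) \<Rightarrow> real"
  assumes "finite A" "finite B" "A \<inter> B = {}"
  shows "measure_pmf.expectation (coins (A \<union> B)) f =
    measure_pmf.expectation (coins A) (\<lambda>x. measure_pmf.expectation (coins B)
      (\<lambda>y. f (\<lambda>i. if i \<in> A then x i else y i)))"
  unfolding coins_def Pi_pmf_union[OF assms]
  using assms finite_set_coins[unfolded coins_def]
  by (simp add: expectation_pair_pmf_finite case_prod_unfold)

text \<open>Coins in \<open>S\<close> and coins outside \<open>S\<close> are independent. So if
  \<open>h\<close> reads its first argument only on \<open>S\<close> and its second only off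
  \<open>S\<close>, the second may be replaced by an independent copy.\<close>

lemma Ex_decouple:
  assumes "\<And>x x' y y'. (\<And>i. i \<in> S \<Longrightarrow> x i = x' i) \<Longrightarrow> (\<And>i. i \<notin> S \<Longrightarrow> y i = y' i) \<Longrightarrow> h x y = h x' y'"
  shows "Ex (\<lambda>x. h x x) = Ex (\<lambda>x. Ex (\<lambda>y. h x y))"
proof -
  have V: "V = (V \<inter> S) \<union> (V - S)" "(V \<inter> S) \<inter> (V - S) = {}" by auto
  have fin: "finite (V \<inter> S)" "finite (V - S)" using finite_V by auto
  let ?m = "\<lambda>x y i. if i \<in> V \<inter> S then x i else (y i :: bool)"
  let ?E1 = "measure_pmf.expectation (coins (V \<inter> S))"
  let ?E2 = "measure_pmf.expectation (coins (V - S))"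
  have dec: "Ex f = ?E1 (\<lambda>x. ?E2 (\<lambda>y. f (?m x y)))" for f
    by (subst V(1), subst expectation_coins_union[OF fin V(2)], rule refl)
  have "Ex (\<lambda>x. Ex (\<lambda>y. h x y)) = ?E1 (\<lambda>x. ?E2 (\<lambda>x'. ?E1 (\<lambda>y'. ?E2 (\<lambda>y. h (?m x x') (?m y' y)))))"
    unfolding dec ..
  \<comment> \<open>\<open>x'\<close> and \<open>y'\<close> supply only coordinates that
    \<open>h\<close> ignores, except those in \<open>S - V\<close>, where every sample is
    \<open>False\<close>. After the replacement they no longer occur in the integrand.\<close>
  also have "\<dots> = ?E1 (\<lambda>x. ?E2 (\<lambda>x'. ?E1 (\<lambda>y'. ?E2 (\<lambda>y. h (?m x y) (?m x y)))))"
  proof (intro integral_cong_AE AE_pmfI)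
    fix x x' y' y
    assume "x \<in> set_pmf (coins (V \<inter> S))" "x' \<in> set_pmf (coins (V - S))"
      "y' \<in> set_pmf (coins (V \<inter> S))" "y \<in> set_pmf (coins (V - S))"
    then show "h (?m x x') (?m y' y) = h (?m x y) (?m x y)"
      using fin by (intro assms) (auto dest: coins_outside)
  qed auto
  also have "\<dots> = Ex (\<lambda>x. h x x)"
    unfolding dec by simp
  finally show ?thesis ..
qed

lemma Ex_prod_indep:
  assumes "finite I" "\<And>i. i \<in> I \<Longrightarrow> depends_on (f i) (T i)"
    and "\<And>i j. i \<in> I \<Longrightarrow> j \<in> I \<Longrightarrow> i \<noteq> j \<Longrightarrow> T i \<inter> T j = {}"
  shows "Ex (\<lambda>x. \<Prod>i\<in>I. f i x) = (\<Prod>i\<in>I. Ex (f i))"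
  using assms
proof (induction I rule: finite_induct)
  case empty
  then show ?case by simp
next
  case (insert k I)
  have "Ex (\<lambda>x. f k x * (\<Prod>i\<in>I. f i x)) = Ex (\<lambda>x. Ex (\<lambda>y. f k x * (\<Prod>i\<in>I. f i y)))"
  proof (rule Ex_decouple[where S = "T k"])
    fix x x' y y' :: "'i \<Rightarrow> bool"
    assume x: "\<And>i. i \<in> T k \<Longrightarrow> x i = x' i" and y: "\<And>i. i \<notin> T k \<Longrightarrow> y i = y' i"
    have "f k x = f k x'"
      using insert.prems(1)[of k] x by (auto intro: depends_onD)
    moreover have "f i y = f i y'" if "i \<in> I" for i
      using that insert.prems(1)[of i] insert.prems(2)[of i k] insert.hyps(2)
      by (intro depends_onD[of "f i" "T i"] y) auto
    ultimately show "f k x * (\<Prod>i\<in>I. f i y) = f k x' * (\<Prod>i\<in>I. f i y')"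
      by simp
  qed
  also have "\<dots> = Ex (f k) * (\<Prod>i\<in>I. Ex (f i))"
    using insert by simp
  finally show ?case
    using insert.hyps by simp
qed

lemma Ex_component:
  assumes "i \<in> V"
  shows "Ex (\<lambda>x. f (x i)) = p * f True + (1 - p) * f False"
proof -
  have "Ex (\<lambda>x. f (x i)) = measure_pmf.expectation (map_pmf (\<lambda>x. x i) (coins V)) f"
    by simp
  also have "\<dots> = measure_pmf.expectation (bernoulli_pmf p) f"
    unfolding coins_def using assms finite_V by (subst Pi_pmf_component) auto
  finally show ?thesis
    using p_nonneg p_le_1 by (simp add: mult.commute)
qed

lemma Ex_two_components:
  assumes "i \<in> V" "j \<in> V" "i \<noteq> j"
  shows "Ex (\<lambda>x. f (x i) (x j)) = p\<^sup>2 * f True True + p * (1 - p) * (f True False + f False True)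
    + (1 - p)\<^sup>2 * f False False"
proof -
  have "Ex (\<lambda>x. f (x i) (x j)) = Ex (\<lambda>x. Ex (\<lambda>y. f (x i) (y j)))"
    using assms by (intro Ex_decouple[where S = "{i}"]) auto
  also have "\<dots> = Ex (\<lambda>x. p * f (x i) True + (1 - p) * f (x i) False)"
    by (simp only: Ex_component[OF assms(2)])
  also have "\<dots> = p\<^sup>2 * f True True + p * (1 - p) * (f True False + f False True)
    + (1 - p)\<^sup>2 * f False False"
    by (subst Ex_component[OF assms(1)]) (simp add: algebra_simps power2_eq_square)
  finally show ?thesis .
qed

lemma Ex_present_absent:
  assumes "J \<subseteq> V" "J' \<subseteq> V" "J \<inter> J' = {}"
  shows "Ex (\<lambda>x. of_bool ((\<forall>i\<in>J. x i) \<and> (\<forall>i\<in>J'. \<not> x i))) = p ^ card J * (1 - p) ^ card J'"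
proof -
  have fin: "finite J" "finite J'" using assms(1,2) finite_V by (auto intro: finite_subset)
  let ?g = "\<lambda>i x. of_bool (x i \<longleftrightarrow> i \<in> J) :: real"
  have "Ex (\<lambda>x. of_bool ((\<forall>i\<in>J. x i) \<and> (\<forall>i\<in>J'. \<not> x i))) = Ex (\<lambda>x. \<Prod>i\<in>J \<union> J'. ?g i x)"
  proof (rule Bochner_Integration.integral_cong)
    fix x :: "'i \<Rightarrow> bool"
    have "(\<Prod>i\<in>J \<union> J'. ?g i x) = of_bool (\<forall>i\<in>J \<union> J'. x i \<longleftrightarrow> i \<in> J)"
      using fin by (intro prod_of_bool_eq) auto
    then show "of_bool ((\<forall>i\<in>J. x i) \<and> (\<forall>i\<in>J'. \<not> x i)) = (\<Prod>i\<in>J \<union> J'. ?g i x)"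
      using assms(3) by (auto simp: of_bool_def)
  qed simp
  also have "\<dots> = (\<Prod>i\<in>J \<union> J'. Ex (?g i))"
    using fin by (intro Ex_prod_indep[where T = "\<lambda>i. {i}"] depends_onI) auto
  also have "\<dots> = (\<Prod>i\<in>J \<union> J'. if i \<in> J then p else 1 - p)"
    using assms by (intro prod.cong refl, subst Ex_component) auto
  also have "\<dots> = (\<Prod>i\<in>J. p) * (\<Prod>i\<in>J'. 1 - p)"
    using assms(3) by (subst prod.union_disjoint[OF fin assms(3)])
      (intro arg_cong2[where f = "(*)"] prod.cong; auto)
  finally show ?thesis by simp
qed

lemma Ex_insert:
  fixes f :: "('i \<Rightarrow> bool) \<Rightarrow> real"
  assumes "finite A" "a \<notin> A"
  shows "measure_pmf.expectation (coins (insert a A)) f =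
    measure_pmf.expectation (coins A) (\<lambda>x. p * f (x(a := True)) + (1 - p) * f (x(a := False)))"
proof -
  have "measure_pmf.expectation (coins (insert a A)) f =
    measure_pmf.expectation (coins (A \<union> {a})) f" by simp
  also have "\<dots> = measure_pmf.expectation (coins A) (\<lambda>x. measure_pmf.expectation (coins {a})
      (\<lambda>y. f (\<lambda>i. if i \<in> A then x i else y i)))"
    by (rule expectation_coins_union) (use assms in auto)
  also have "\<dots> = measure_pmf.expectation (coins A) (\<lambda>x. p * f (x(a := True)) + (1 - p) * f (x(a := False)))"
  proof (intro integral_cong_AE AE_pmfI)
    fix x assume x: "x \<in> set_pmf (coins A)"
    have off: "x i = False" if "i \<notin> A" for i
      using that x assms(1) by (auto dest: coins_outside)
    have "coins {a} = map_pmf (\<lambda>v. (\<lambda>_. False)(a := v)) (bernoulli_pmf p)"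
      unfolding coins_def by (subst Pi_pmf_singleton) (auto intro!: map_pmf_cong simp: fun_upd_def)
    moreover have "(\<lambda>i. if i \<in> A then x i else ((\<lambda>_. False)(a := v)) i) = x(a := v)" for v
      using assms off by (auto simp: fun_eq_iff)
    ultimately show "measure_pmf.expectation (coins {a}) (\<lambda>y. f (\<lambda>i. if i \<in> A then x i else y i)) =
      p * f (x(a := True)) + (1 - p) * f (x(a := False))"
      using p_nonneg p_le_1 by (simp add: mult.commute)
  qed auto
  finally show ?thesis .
qed

text \<open>Averaging over the coin \<open>a\<close> gives a function \<open>g\<close> of the other
  coins that is again Lipschitz. By the law of total variance, the variance of \<open>f\<close> is
  that of \<open>g\<close> plus the mean two-point variance at \<open>a\<close>, which is at most 1.
  Hence the induction is over all \<open>f\<close>.\<close>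

lemma Efron_Stein_Lipschitz:
  fixes f :: "('i \<Rightarrow> bool) \<Rightarrow> real"
  assumes "finite A" and "\<And>x a. \<bar>f (x(a := True)) - f (x(a := False))\<bar> \<le> 1"
  shows "measure_pmf.variance (coins A) f \<le> card A"
  using assms
proof (induction A arbitrary: f rule: finite_induct)
  case empty
  then show ?case by (simp add: coins_def)
next
  case (insert a A)
  let ?E = "measure_pmf.expectation (coins A)"
  define g where "g x = p * f (x(a := True)) + (1 - p) * f (x(a := False))" for x
  have int: "integrable (measure_pmf (coins A)) (h :: _ \<Rightarrow> real)" for h
    by (intro integrable_measure_pmf_finite finite_set_coins insert)
  have Ef: "measure_pmf.expectation (coins (insert a A)) f = ?E g"
    unfolding g_def using insert by (intro Ex_insert)
  have "\<bar>g (x(b := True)) - g (x(b := False))\<bar> \<le> 1" for x b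
  proof (cases "b = a")
    case False
    have "\<bar>g (x(b := True)) - g (x(b := False))\<bar> =
      \<bar>p * (f ((x(a := True))(b := True)) - f ((x(a := True))(b := False))) +
       (1 - p) * (f ((x(a := False))(b := True)) - f ((x(a := False))(b := False)))\<bar>"
      using False by (simp add: g_def fun_upd_twist algebra_simps)
    also have "\<dots> \<le> p * 1 + (1 - p) * 1"
      by (intro order.trans[OF abs_triangle_ineq] add_mono)
         (use insert.prems p_nonneg p_le_1 in \<open>auto simp: abs_mult simp del: fun_upd_apply intro!: mult_left_le\<close>)
    finally show ?thesis by simp
  qed (simp add: g_def)
  then have IH: "?E (\<lambda>x. (g x - ?E g)\<^sup>2) \<le> card A"
    by (rule insert.IH)
  have "measure_pmf.variance (coins (insert a A)) f =
    ?E (\<lambda>x. p * (f (x(a := True)) - ?E g)\<^sup>2 + (1 - p) * (f (x(a := False)) - ?E g)\<^sup>2)"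
    unfolding Ef using insert by (intro Ex_insert)
  also have "\<dots> \<le> ?E (\<lambda>x. (g x - ?E g)\<^sup>2 + 1)"
  proof (intro integral_mono int)
    fix x
    let ?s = "f (x(a := True))" and ?t = "f (x(a := False))"
    have "p * (1 - p) * (?s - ?t)\<^sup>2 \<le> 1 * 1"
      using insert.prems[of x a] p_nonneg p_le_1
      by (intro mult_mono mult_le_one) (auto simp: abs_square_le_1 simp del: fun_upd_apply)
    moreover have "p * (?s - ?E g)\<^sup>2 + (1 - p) * (?t - ?E g)\<^sup>2 =
      (g x - ?E g)\<^sup>2 + p * (1 - p) * (?s - ?t)\<^sup>2"
      unfolding g_def by algebra
    ultimately show "p * (?s - ?E g)\<^sup>2 + (1 - p) * (?t - ?E g)\<^sup>2 \<le> (g x - ?E g)\<^sup>2 + 1"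
      by simp
  qed
  also have "\<dots> = ?E (\<lambda>x. (g x - ?E g)\<^sup>2) + 1"
    by (subst Bochner_Integration.integral_add) (auto simp: int)
  finally show ?case
    using IH insert.hyps by simp
qed

end

section \<open>Jensen's inequality for powers\<close>

lemma power_ge_tangent:
  fixes y z :: real
  assumes "0 \<le> y" "0 \<le> z"
  shows "z ^ k + k * z ^ (k - 1) * (y - z) \<le> y ^ k"
proof (induction k)
  case 0
  then show ?case by simp
next
  case (Suc k)
  define c where "c = k * z ^ (k - 1)"
  have "k * z ^ k = c * z"
    unfolding c_def by (cases k) auto
  \<comment> \<open>With \<open>z ^ k\<close> for \<open>W\<close> and \<open>k\<close> for
    \<open>K\<close>: multiplying the tangent bound for \<open>k\<close> by \<open>y\<close> gives
    the one for \<open>Suc k\<close> plus the nonnegative excess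
    \<open>c * (y - z)\<^sup>2\<close>.\<close>
  moreover have "y * (W + c * (y - z)) = z * W + (W + K * W) * (y - z) + c * (y - z)\<^sup>2"
    if "K * W = c * z" for K W
    unfolding distrib_right that by (simp add: algebra_simps power2_eq_square)
  ultimately have "y * (z ^ k + c * (y - z)) = z * z ^ k + (z ^ k + k * z ^ k) * (y - z) + c * (y - z)\<^sup>2"
    by blast
  moreover have "0 \<le> c * (y - z)\<^sup>2"
    unfolding c_def using assms by simp
  ultimately have "z ^ Suc k + Suc k * z ^ (Suc k - 1) * (y - z) \<le> y * (z ^ k + k * z ^ (k - 1) * (y - z))"
    unfolding c_def by (simp add: algebra_simps)
  also have "\<dots> \<le> y * y ^ k"
    using Suc assms by (intro mult_left_mono) auto
  finally show ?case by simp
qed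

text \<open>The tangent to \<open>y ^ k\<close> at \<open>1 - s\<close> has a linear term of
  \<open>D\<close>-weighted mean zero. The weight is left unnormalised, so no conditional measure is
  needed; in the application \<open>D\<close> is an indicator.\<close>

lemma Jensen_power_expectation:
  fixes M :: "'a pmf" and D t :: "'a \<Rightarrow> real" and s :: real
  assumes fin: "finite (set_pmf M)"
    and "\<And>x. 0 \<le> D x" "\<And>x. t x \<le> 1" "s \<le> 1"
    and mean: "measure_pmf.expectation M (\<lambda>x. D x * t x) = measure_pmf.expectation M D * s"
  shows "measure_pmf.expectation M D * (1 - s) ^ k \<le> measure_pmf.expectation M (\<lambda>x. D x * (1 - t x) ^ k)"
proof -
  have int: "integrable (measure_pmf M) f" for f :: "'a \<Rightarrow> real"
    using fin by (rule integrable_measure_pmf_finite)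
  let ?c = "k * (1 - s) ^ (k - 1)"
  have "measure_pmf.expectation M (\<lambda>x. D x * ((1 - s) ^ k + ?c * ((1 - t x) - (1 - s))))
      = measure_pmf.expectation M (\<lambda>x. ((1 - s) ^ k + ?c * s) * D x - ?c * (D x * t x))"
    by (intro Bochner_Integration.integral_cong) (auto simp: algebra_simps)
  also have "\<dots> = ((1 - s) ^ k + ?c * s) * measure_pmf.expectation M D - ?c * (measure_pmf.expectation M D * s)"
    by (subst Bochner_Integration.integral_diff) (simp_all add: int mean)
  also have "\<dots> = measure_pmf.expectation M D * (1 - s) ^ k"
    by (simp add: algebra_simps)
  finally have "measure_pmf.expectation M D * (1 - s) ^ k =
    measure_pmf.expectation M (\<lambda>x. D x * ((1 - s) ^ k + ?c * ((1 - t x) - (1 - s))))" ..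
  also have "\<dots> \<le> measure_pmf.expectation M (\<lambda>x. D x * (1 - t x) ^ k)"
    using assms by (intro integral_mono int mult_left_mono power_ge_tangent) auto
  finally show ?thesis .
qed

section \<open>The cover associated with a bipartition\<close>

text \<open>An edge \<open>uv\<close> inside \<open>A\<close> is redundant if it lies in no triangle with apex in \<open>B\<close>, and every
  triangle \<open>uvw\<close> inside \<open>A\<close> has another edge that does lie in one. As \<open>uv\<close> has no common neighbour
  in \<open>B\<close>, the latter says that \<open>w\<close> is adjacent to a vertex of \<open>B\<close> adjacent to \<open>u\<close> or \<open>v\<close>.\<close>

definition redundant :: "'a set set \<Rightarrow> 'a set \<Rightarrow> 'a set \<Rightarrow> 'a \<Rightarrow> 'a \<Rightarrow> bool" where
  "redundant E A B u v \<longleftrightarrow>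
     (\<forall>b\<in>B. \<not> ({u, b} \<in> E \<and> {v, b} \<in> E)) \<and>
     (\<forall>w\<in>A - {u, v}. \<not> ({u, w} \<in> E \<and> {v, w} \<in> E \<and>
        (\<forall>b\<in>B. {u, b} \<in> E \<or> {v, b} \<in> E \<longrightarrow> {w, b} \<notin> E)))"

definition sided_cover :: "'a set set \<Rightarrow> 'a set \<Rightarrow> 'a set \<Rightarrow> 'a set set" where
  "sided_cover E A B = {{u, v} | u v. u \<in> A \<and> v \<in> A \<and> u \<noteq> v \<and> {u, v} \<in> E \<and> \<not> redundant E A B u v}"

lemma redundant_commute: "redundant E A B u v \<longleftrightarrow> redundant E A B v u"
  unfolding redundant_def by (auto simp: insert_commute)

lemma sided_cover_iff:
  assumes "u \<in> A" "v \<in> A" "u \<noteq> v"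
  shows "{u, v} \<in> sided_cover E A B \<longleftrightarrow> {u, v} \<in> E \<and> \<not> redundant E A B u v"
  using assms unfolding sided_cover_def by (auto simp: doubleton_eq_iff redundant_commute[of E A B v u] insert_commute)

lemma sided_cover_crossing:
  assumes "x \<in> A" "y \<in> A" "z \<in> B" "x \<noteq> y" "{x, y} \<in> E" "{x, z} \<in> E" "{y, z} \<in> E"
  shows "{x, y} \<in> sided_cover E A B"
  using assms by (auto simp: sided_cover_iff redundant_def)

text \<open>The monochromatic case. If all three edges were redundant, redundancy of
  \<open>xy\<close> would give a vertex of \<open>B\<close> adjacent to \<open>z\<close> and to
  \<open>x\<close> or \<open>y\<close>, that is, an apex over \<open>xz\<close> or
  \<open>yz\<close>, contradicting their redundancy.\<close>

lemma sided_cover_mono: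
  assumes "x \<in> A" "y \<in> A" "z \<in> A" "x \<noteq> y" "y \<noteq> z" "x \<noteq> z" "{x, y} \<in> E" "{y, z} \<in> E" "{x, z} \<in> E"
  shows "{x, y} \<in> sided_cover E A B \<or> {y, z} \<in> sided_cover E A B \<or> {x, z} \<in> sided_cover E A B"
proof (rule ccontr)
  assume "\<not> ?thesis"
  then have "redundant E A B x y" "redundant E A B y z" "redundant E A B x z"
    using assms by (auto simp: sided_cover_iff)
  then show False
    using assms unfolding redundant_def by (auto simp: insert_commute)
qed

lemma sided_covers_hit_triangle:
  assumes "\<Union> E \<subseteq> A \<union> B" "T \<in> triangles E"
  shows "(sided_cover E A B \<union> sided_cover E B A) \<inter> T \<noteq> {}"
proof -
  obtain x y z where T: "T = {{x, y}, {y, z}, {x, z}}" and ne: "x \<noteq> y" "y \<noteq> z" "x \<noteq> z"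
    and E: "{x, y} \<in> E" "{y, z} \<in> E" "{x, z} \<in> E"
    using assms(2) unfolding triangles_def by blast
  have E': "{y, x} \<in> E" "{z, y} \<in> E" "{z, x} \<in> E"
    using E by (simp_all add: insert_commute)
  have side: "x \<in> A \<union> B" "y \<in> A \<union> B" "z \<in> A \<union> B"
    using assms(1) E by auto
  \<comment> \<open>By pigeonhole two vertices share a side \<open>P\<close>; the third lies in
    \<open>P\<close> (monochromatic case) or in \<open>Q\<close> (crossing case).\<close>
  have two: "{x, y} \<in> sided_cover E P Q \<or> {y, z} \<in> sided_cover E P Q \<or> {x, z} \<in> sided_cover E P Q"
    if "x \<in> P \<and> y \<in> P \<and> z \<in> P \<union> Q \<or> y \<in> P \<and> z \<in> P \<and> x \<in> P \<union> Q \<or> x \<in> P \<and> z \<in> P \<and> y \<in> P \<union> Q" for P Q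
    using that ne E E' sided_cover_mono[of x P y z E Q]
      sided_cover_crossing[of x P y z Q E] sided_cover_crossing[of y P z x Q E]
      sided_cover_crossing[of x P z y Q E] by blast
  show ?thesis
    using side two[of A B] two[of B A] unfolding T by blast
qed

section \<open>The cover number and its change when an edge is added\<close>

lemma triangle_cover_number_le:
  assumes "F \<subseteq> E" "finite F" "\<And>T. T \<in> triangles E \<Longrightarrow> F \<inter> T \<noteq> {}"
  shows "triangle_cover_number E \<le> card F"
  unfolding triangle_cover_number_def using assms by (intro Least_le) blast

lemma ex_minimum_triangle_cover:
  assumes "finite E"
  obtains F where "F \<subseteq> E" "finite F" "card F = triangle_cover_number E"
    "\<And>T. T \<in> triangles E \<Longrightarrow> F \<inter> T \<noteq> {}"
proof -
  have "\<forall>T \<in> triangles E. E \<inter> T \<noteq> {}"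
    unfolding triangles_def by auto
  then have "\<exists>k F. F \<subseteq> E \<and> finite F \<and> card F = k \<and> (\<forall>T \<in> triangles E. F \<inter> T \<noteq> {})"
    using assms by blast
  from LeastI_ex[OF this] show ?thesis
    unfolding triangle_cover_number_def[symmetric] using that by blast
qed

text \<open>Removing \<open>e\<close> from a cover of the larger graph leaves a cover of the smaller
  one, whose triangles avoid \<open>e\<close>; adding \<open>e\<close> to a cover of the smaller
  graph hits every new triangle.\<close>

lemma triangle_cover_number_insert:
  assumes "finite E" "e \<notin> E"
  shows "triangle_cover_number E \<le> triangle_cover_number (insert e E)"
    and "triangle_cover_number (insert e E) \<le> Suc (triangle_cover_number E)"
proof -
  obtain F where F: "F \<subseteq> insert e E" "finite F" "card F = triangle_cover_number (insert e E)"
    "\<And>T. T \<in> triangles (insert e E) \<Longrightarrow> F \<inter> T \<noteq> {}"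
    using assms ex_minimum_triangle_cover[of "insert e E"] by auto
  have "triangle_cover_number E \<le> card (F - {e})"
  proof (rule triangle_cover_number_le)
    fix T assume T: "T \<in> triangles E"
    then have "T \<subseteq> E" "T \<in> triangles (insert e E)" unfolding triangles_def by blast+
    then show "(F - {e}) \<inter> T \<noteq> {}" using F(4) assms(2) by blast
  qed (use F in auto)
  also have "\<dots> \<le> card F" using F(2) by (intro card_mono) auto
  finally show "triangle_cover_number E \<le> triangle_cover_number (insert e E)" using F by simp
next
  obtain F where F: "F \<subseteq> E" "finite F" "card F = triangle_cover_number E"
    "\<And>T. T \<in> triangles E \<Longrightarrow> F \<inter> T \<noteq> {}"
    using assms ex_minimum_triangle_cover[of E] by auto
  have "triangle_cover_number (insert e E) \<le> card (insert e F)"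
  proof (rule triangle_cover_number_le)
    fix T assume T: "T \<in> triangles (insert e E)"
    show "insert e F \<inter> T \<noteq> {}"
    proof (cases "e \<in> T")
      case False
      then have "T \<in> triangles E" using T unfolding triangles_def by blast
      then show ?thesis using F(4) by blast
    qed auto
  qed (use F in auto)
  also have "\<dots> \<le> Suc (card F)" using F(2) by (simp add: card_insert_if)
  finally show "triangle_cover_number (insert e E) \<le> Suc (triangle_cover_number E)" using F by simp
qed

section \<open>The expected size of the cover\<close>

lemma doubleton_in_potential_edges [simp]:
  "u \<noteq> v \<Longrightarrow> {u, v} \<in> potential_edges n \<longleftrightarrow> u \<in> {1..n} \<and> v \<in> {1..n}"
  unfolding potential_edges_def by auto

lemma finite_potential_edges: "finite (potential_edges n)"
  unfolding potential_edges_def by (rule finite_subset[of _ "Pow {1..n}"]) auto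

lemma card_potential_edges: "card (potential_edges n) = n choose 2"
  unfolding potential_edges_def using n_subsets[of "{1..n}" 2] by simp

definition present_edges :: "nat \<Rightarrow> (nat set \<Rightarrow> bool) \<Rightarrow> nat set set" where
  "present_edges n x = {e \<in> potential_edges n. x e}"

lemma finite_present_edges: "finite (present_edges n x)"
  unfolding present_edges_def using finite_potential_edges by auto

text \<open>All pairs involved are potential edges, so membership becomes a coin. The opposite
  vertices are collected in the set later called \<open>touched\<close>.\<close>

lemma redundant_present_edges:
  assumes "A \<union> B = {1..n}" "A \<inter> B = {}" "u \<in> A" "v \<in> A" "u \<noteq> v"
  shows "redundant (present_edges n x) A B u v \<longleftrightarrow>
     (\<forall>b\<in>B. \<not> (x {u, b} \<and> x {v, b})) \<and>
     (\<forall>w\<in>A - {u, v}. \<not> (x {u, w} \<and> x {v, w} \<and>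
        (\<forall>b\<in>{b\<in>B. x {u, b} \<or> x {v, b}}. \<not> x {w, b})))"
proof -
  have e: "{a, b} \<in> present_edges n x \<longleftrightarrow> x {a, b}" if "a \<in> A" "b \<in> A \<union> B" "a \<noteq> b" for a b
    using that assms by (auto simp: present_edges_def)
  have "u \<noteq> b" "v \<noteq> b" "w \<noteq> b" if "b \<in> B" "w \<in> A" for b w
    using that assms by auto
  then show ?thesis
    unfolding redundant_def using assms(3,4) by (auto simp: e)
qed

text \<open>The first factor is the probability that \<open>uv\<close> has no common neighbour among the \<open>b\<close> vertices
  of the opposite side. Conditionally on this, \<open>1 - 2 * p\<^sup>2 / (1 + p)\<close> is the probability that a
  given opposite vertex does not join \<open>w\<close> to \<open>u\<close> or \<open>v\<close>.\<close>

definition keep_bound :: "real \<Rightarrow> nat \<Rightarrow> nat \<Rightarrow> real" where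
  "keep_bound p a b = (1 - p\<^sup>2) ^ b * (1 - p\<^sup>2 * (1 - 2 * p\<^sup>2 / (1 + p)) ^ b) ^ (a - 2)"

section \<open>The probability that an edge inside a half is redundant\<close>

locale gnp_bipartition = bernoulli_product "potential_edges n" p for n p +
  fixes A B :: "nat set"
  assumes union_eq: "A \<union> B = {1..n}" and disj: "A \<inter> B = {}"
begin

lemma finite_AB: "finite A" "finite B"
  using union_eq by (metis finite_Un finite_atLeastAtMost)+

lemma in_vertices: "u \<in> A \<Longrightarrow> u \<in> {1..n}" "u \<in> B \<Longrightarrow> u \<in> {1..n}"
  using union_eq by auto

text \<open>\<open>(1 - p)\<^sup>2 * (1 + 2 * p)\<close> is the factor per opposite vertex in
  \<open>Ex_uncrossed_touched\<close>; the identity splits off the factor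
  \<open>1 - p\<^sup>2\<close> of \<open>Ex_uncrossed\<close>.\<close>

lemma keep_factors:
  shows "(1 - p\<^sup>2) * (1 - 2 * p\<^sup>2 / (1 + p)) = (1 - p)\<^sup>2 * (1 + 2 * p)"
    and "0 \<le> 1 - 2 * p\<^sup>2 / (1 + p)" "1 - 2 * p\<^sup>2 / (1 + p) \<le> 1"
proof -
  have "1 + p > 0" using p_nonneg by simp
  then show "(1 - p\<^sup>2) * (1 - 2 * p\<^sup>2 / (1 + p)) = (1 - p)\<^sup>2 * (1 + 2 * p)"
    by (simp add: field_simps power2_eq_square)
  have "p\<^sup>2 \<le> p" using p_nonneg p_le_1 by (simp add: power2_eq_square mult_left_le)
  then show "0 \<le> 1 - 2 * p\<^sup>2 / (1 + p)" "1 - 2 * p\<^sup>2 / (1 + p) \<le> 1"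
    using p_nonneg p_le_1 by (auto simp: field_simps)
qed

context
  fixes u v assumes uv: "u \<in> A" "v \<in> A" "u \<noteq> v"
begin

definition touched :: "(nat set \<Rightarrow> bool) \<Rightarrow> nat set" where
  "touched x = {b\<in>B. x {u, b} \<or> x {v, b}}"

definition uncrossed :: "(nat set \<Rightarrow> bool) \<Rightarrow> bool" where
  "uncrossed x \<longleftrightarrow> (\<forall>b\<in>B. \<not> (x {u, b} \<and> x {v, b}))"

text \<open>\<open>K\<close> is a separate argument so that it can come from one sample, as
  \<open>touched x\<close>, while the edges at \<open>w\<close> come from another.\<close>

definition bad_apex :: "nat set \<Rightarrow> nat \<Rightarrow> (nat set \<Rightarrow> bool) \<Rightarrow> bool" where
  "bad_apex K w y \<longleftrightarrow> y {u, w} \<and> y {v, w} \<and> (\<forall>b\<in>K. \<not> y {w, b})"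

lemma uv_notin_B: "b \<in> B \<Longrightarrow> u \<noteq> b \<and> v \<noteq> b"
  using uv disj by auto

lemma Ex_bad_apex:
  assumes "w \<in> A - {u, v}" "K \<subseteq> B"
  shows "Ex (\<lambda>y. of_bool (\<not> bad_apex K w y)) = 1 - p\<^sup>2 * (1 - p) ^ card K"
proof -
  have wK: "w \<noteq> b" if "b \<in> K" for b using that assms disj by auto
  have "Ex (\<lambda>y. of_bool (bad_apex K w y)) =
    Ex (\<lambda>y. of_bool ((\<forall>e\<in>{{u, w}, {v, w}}. y e) \<and> (\<forall>e\<in>(\<lambda>b. {w, b}) ` K. \<not> y e)))"
    by (simp add: bad_apex_def)
  also have "\<dots> = p ^ card {{u, w}, {v, w}} * (1 - p) ^ card ((\<lambda>b. {w, b}) ` K)"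
  proof (rule Ex_present_absent)
    show "{{u, w}, {v, w}} \<subseteq> potential_edges n"
      using assms uv in_vertices by auto
    show "(\<lambda>b. {w, b}) ` K \<subseteq> potential_edges n"
      using assms wK in_vertices by (auto 0 3)
    show "{{u, w}, {v, w}} \<inter> (\<lambda>b. {w, b}) ` K = {}"
      using assms uv uv_notin_B by (auto simp: doubleton_eq_iff)
  qed
  also have "card {{u, w}, {v, w}} = 2"
    using assms uv by (auto simp: doubleton_eq_iff card_insert_if)
  also have "card ((\<lambda>b. {w, b}) ` K) = card K"
    by (intro card_image inj_onI) (auto simp: doubleton_eq_iff)
  finally show ?thesis
    by (simp add: of_bool_not_iff)
qed

text \<open>Exposing the edges between \<open>{u, v}\<close> and \<open>B\<close> first makes the events
  \<open>bad_apex\<close> for different apexes conditionally independent.\<close>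

lemma Ex_redundant_eq:
  "Ex (\<lambda>x. of_bool (redundant (present_edges n x) A B u v)) =
   Ex (\<lambda>x. of_bool (uncrossed x) * (1 - p\<^sup>2 * (1 - p) ^ card (touched x)) ^ (card A - 2))"
proof -
  let ?W = "A - {u, v}"
  let ?h = "\<lambda>x y. of_bool (uncrossed x) * (\<Prod>w\<in>?W. of_bool (\<not> bad_apex (touched x) w y)) :: real"
  let ?S = "{{s, b} | s b. s \<in> {u, v} \<and> b \<in> B}"
  have finW: "finite ?W" using finite_AB by auto
  have "redundant (present_edges n x) A B u v \<longleftrightarrow>
      uncrossed x \<and> (\<forall>w\<in>?W. \<not> bad_apex (touched x) w x)" for x
    unfolding redundant_present_edges[OF union_eq disj uv] uncrossed_def bad_apex_def touched_def ..
  then have "Ex (\<lambda>x. of_bool (redundant (present_edges n x) A B u v)) = Ex (\<lambda>x. ?h x x)"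
    by (simp only: prod_of_bool_eq[OF finW] of_bool_conj)
  also have "\<dots> = Ex (\<lambda>x. Ex (\<lambda>y. ?h x y))"
  proof (rule Ex_decouple[where S = ?S])
    fix x x' y y' :: "nat set \<Rightarrow> bool"
    assume x: "\<And>i. i \<in> ?S \<Longrightarrow> x i = x' i" and y: "\<And>i. i \<notin> ?S \<Longrightarrow> y i = y' i"
    have "x {u, b} = x' {u, b}" "x {v, b} = x' {v, b}" if "b \<in> B" for b
      using that by (auto intro!: x)
    then have "uncrossed x = uncrossed x'" "touched x = touched x'"
      unfolding uncrossed_def touched_def by auto
    moreover have "bad_apex (touched x) w y = bad_apex (touched x) w y'" if w: "w \<in> ?W" for w
    proof -
      have "y {u, w} = y' {u, w}" "y {v, w} = y' {v, w}"
        using w uv disj by (auto intro!: y simp: doubleton_eq_iff)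
      moreover have "y {w, b} = y' {w, b}" if "b \<in> touched x" for b
        using w uv disj that by (intro y) (auto simp: doubleton_eq_iff touched_def)
      ultimately show ?thesis unfolding bad_apex_def by auto
    qed
    ultimately show "?h x y = ?h x' y'"
      by simp
  qed
  also have "\<dots> = Ex (\<lambda>x. of_bool (uncrossed x) * (1 - p\<^sup>2 * (1 - p) ^ card (touched x)) ^ (card A - 2))"
  proof (intro Bochner_Integration.integral_cong refl)
    fix x
    have sub: "touched x \<subseteq> B" by (auto simp: touched_def)
    have "Ex (\<lambda>y. \<Prod>w\<in>?W. of_bool (\<not> bad_apex (touched x) w y)) =
        (\<Prod>w\<in>?W. Ex (\<lambda>y. of_bool (\<not> bad_apex (touched x) w y)))"
    \<comment> \<open>These pairs join \<open>w\<close> to \<open>u\<close>, \<open>v\<close> or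
      \<open>B\<close>, never to another apex, so the sets for distinct apexes are disjoint.\<close>
    proof (rule Ex_prod_indep[where T = "\<lambda>w. {{u, w}, {v, w}} \<union> (\<lambda>b. {w, b}) ` B"])
      fix w assume "w \<in> ?W"
      show "depends_on (\<lambda>y. of_bool (\<not> bad_apex (touched x) w y))
          ({{u, w}, {v, w}} \<union> (\<lambda>b. {w, b}) ` B)"
      proof (rule depends_onI)
        fix y y' :: "nat set \<Rightarrow> bool"
        assume eq: "\<And>i. i \<in> {{u, w}, {v, w}} \<union> (\<lambda>b. {w, b}) ` B \<Longrightarrow> y i = y' i"
        have "bad_apex (touched x) w y = bad_apex (touched x) w y'"
          unfolding bad_apex_def using sub by (intro conj_cong ball_cong refl arg_cong[of _ _ Not] eq) auto
        then show "of_bool (\<not> bad_apex (touched x) w y) = of_bool (\<not> bad_apex (touched x) w y')"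
          by simp
      qed
    next
      fix w w' assume "w \<in> ?W" "w' \<in> ?W" "w \<noteq> w'"
      then show "({{u, w}, {v, w}} \<union> (\<lambda>b. {w, b}) ` B) \<inter> ({{u, w'}, {v, w'}} \<union> (\<lambda>b. {w', b}) ` B) = {}"
        using uv disj by (auto simp: doubleton_eq_iff)
    qed (rule finW)
    also have "\<dots> = (1 - p\<^sup>2 * (1 - p) ^ card (touched x)) ^ card ?W"
      using sub by (simp add: Ex_bad_apex)
    also have "card ?W = card A - 2"
      using uv finite_AB by (simp add: card_Diff_subset)
    finally show "Ex (\<lambda>y. ?h x y) =
        of_bool (uncrossed x) * (1 - p\<^sup>2 * (1 - p) ^ card (touched x)) ^ (card A - 2)"
      by simp
  qed
  finally show ?thesis .
qed

lemma Ex_prod_over_B: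
  "Ex (\<lambda>x. \<Prod>b\<in>B. g (x {u, b}) (x {v, b})) =
   (p\<^sup>2 * g True True + p * (1 - p) * (g True False + g False True) + (1 - p)\<^sup>2 * g False False) ^ card B"
proof -
  have "Ex (\<lambda>x. \<Prod>b\<in>B. g (x {u, b}) (x {v, b})) = (\<Prod>b\<in>B. Ex (\<lambda>x. g (x {u, b}) (x {v, b})))"
    using uv uv_notin_B finite_AB
    by (intro Ex_prod_indep[where T = "\<lambda>b. {{u, b}, {v, b}}"] depends_onI) (auto simp: doubleton_eq_iff)
  also have "\<dots> = (\<Prod>b\<in>B. p\<^sup>2 * g True True + p * (1 - p) * (g True False + g False True) +
      (1 - p)\<^sup>2 * g False False)"
    using uv uv_notin_B in_vertices
    by (intro prod.cong refl Ex_two_components) (auto simp: doubleton_eq_iff)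
  finally show ?thesis by simp
qed

lemma Ex_uncrossed: "Ex (\<lambda>x. of_bool (uncrossed x)) = (1 - p\<^sup>2) ^ card B"
proof -
  have "Ex (\<lambda>x. of_bool (uncrossed x)) = Ex (\<lambda>x. \<Prod>b\<in>B. of_bool (\<not> (x {u, b} \<and> x {v, b})))"
    unfolding uncrossed_def prod_of_bool_eq[OF finite_AB(2)] ..
  also have "\<dots> = (1 - p\<^sup>2) ^ card B"
    by (subst Ex_prod_over_B[where g = "\<lambda>s t. of_bool (\<not> (s \<and> t))"])
       (simp add: power2_eq_square algebra_simps)
  finally show ?thesis .
qed

text \<open>A vertex of \<open>B\<close> contributes 0 if joined to both \<open>u\<close> and
  \<open>v\<close>, \<open>1 - p\<close> if joined to exactly one, and 1 if joined to
  neither.\<close>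

lemma Ex_uncrossed_touched:
  "Ex (\<lambda>x. of_bool (uncrossed x) * (1 - p) ^ card (touched x)) = ((1 - p)\<^sup>2 * (1 + 2 * p)) ^ card B"
proof -
  let ?g = "\<lambda>s t. of_bool (\<not> (s \<and> t)) * (if s \<or> t then 1 - p else 1) :: real"
  have "of_bool (uncrossed x) * (1 - p) ^ card (touched x) = (\<Prod>b\<in>B. ?g (x {u, b}) (x {v, b}))" for x
  proof -
    have "(1 - p) ^ card (touched x) = (\<Prod>b\<in>B. if x {u, b} \<or> x {v, b} then 1 - p else 1)"
      unfolding touched_def by (subst prod.inter_filter[symmetric]) (simp_all add: finite_AB)
    then show ?thesis
      unfolding uncrossed_def prod.distrib prod_of_bool_eq[OF finite_AB(2)] by simp
  qed
  then have "Ex (\<lambda>x. of_bool (uncrossed x) * (1 - p) ^ card (touched x)) =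
      Ex (\<lambda>x. \<Prod>b\<in>B. ?g (x {u, b}) (x {v, b}))"
    by simp
  also have "\<dots> = ((1 - p)\<^sup>2 * (1 + 2 * p)) ^ card B"
    by (subst Ex_prod_over_B[where g = ?g]) (simp add: power2_eq_square algebra_simps)
  finally show ?thesis .
qed

text \<open>Jensen's inequality replaces the random number of touched vertices by its effect on average, so no
  concentration of degrees is needed.\<close>

lemma keep_bound_le: "keep_bound p (card A) (card B) \<le> Ex (\<lambda>x. of_bool (redundant (present_edges n x) A B u v))"
proof -
  let ?s = "p\<^sup>2 * (1 - 2 * p\<^sup>2 / (1 + p)) ^ card B"
  let ?t = "\<lambda>x. p\<^sup>2 * (1 - p) ^ card (touched x)"
  \<comment> \<open>The mean of \<open>?t\<close> weighted by \<open>uncrossed\<close> is that of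
    the constant \<open>?s\<close>, as Jensen's inequality requires.\<close>
  have "Ex (\<lambda>x. of_bool (uncrossed x) * ?t x) = p\<^sup>2 * Ex (\<lambda>x. of_bool (uncrossed x) * (1 - p) ^ card (touched x))"
    by (subst integral_mult_right_zero[symmetric]) (simp add: mult_ac)
  also have "\<dots> = Ex (\<lambda>x. of_bool (uncrossed x)) * ?s"
    unfolding Ex_uncrossed Ex_uncrossed_touched keep_factors(1)[symmetric] power_mult_distrib by simp
  finally have "Ex (\<lambda>x. of_bool (uncrossed x)) * (1 - ?s) ^ (card A - 2) \<le>
      Ex (\<lambda>x. of_bool (uncrossed x) * (1 - ?t x) ^ (card A - 2))"
    using p_nonneg p_le_1 keep_factors(2,3)
    by (intro Jensen_power_expectation finite_set_coins finite_V)
       (auto intro!: mult_le_one power_le_one)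
  then show ?thesis
    unfolding Ex_redundant_eq keep_bound_def Ex_uncrossed .
qed

text \<open>Every pair read by redundancy of \<open>uv\<close> has an endpoint outside
  \<open>{u, v}\<close>, so redundancy is independent of the presence of \<open>uv\<close>
  itself.\<close>

lemma Ex_in_sided_cover_le:
  "Ex (\<lambda>x. of_bool ({u, v} \<in> sided_cover (present_edges n x) A B)) \<le> p * (1 - keep_bound p (card A) (card B))"
proof -
  have uvE: "{u, v} \<in> present_edges n x \<longleftrightarrow> x {u, v}" for x
    using uv in_vertices by (auto simp: present_edges_def)
  let ?R = "\<lambda>x. redundant (present_edges n x) A B u v"
  have "Ex (\<lambda>x. of_bool ({u, v} \<in> sided_cover (present_edges n x) A B)) =
      Ex (\<lambda>x. of_bool (x {u, v}) * of_bool (\<not> ?R x))"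
    by (simp only: sided_cover_iff[OF uv] uvE of_bool_conj)
  also have "\<dots> = Ex (\<lambda>x. Ex (\<lambda>y. of_bool (x {u, v}) * of_bool (\<not> ?R y)))"
  proof (rule Ex_decouple[where S = "{{u, v}}"])
    fix x x' y y' :: "nat set \<Rightarrow> bool"
    assume x: "\<And>i. i \<in> {{u, v}} \<Longrightarrow> x i = x' i" and y: "\<And>i. i \<notin> {{u, v}} \<Longrightarrow> y i = y' i"
    have y': "y {a, b} = y' {a, b}" if "b \<notin> {u, v}" for a b
      using that by (intro y) (auto simp: doubleton_eq_iff)
    have yB: "y {a, b} = y' {a, b}" if "b \<in> B" for a b
      using that uv disj by (intro y') auto
    have yA: "y {a, w} = y' {a, w}" if "w \<noteq> u" "w \<noteq> v" for a w
      using that by (intro y') auto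
    have "?R y = ?R y'"
      unfolding redundant_present_edges[OF union_eq disj uv]
      by (intro conj_cong ball_cong refl) (simp_all add: yA yB cong: conj_cong)
    then show "of_bool (x {u, v}) * of_bool (\<not> ?R y) = (of_bool (x' {u, v}) * of_bool (\<not> ?R y') :: real)"
      using x by simp
  qed
  also have "\<dots> = Ex (\<lambda>x. of_bool (x {u, v})) * (1 - Ex (\<lambda>x. of_bool (?R x)))"
    by (simp add: of_bool_not_iff)
  also have "Ex (\<lambda>x. of_bool (x {u, v})) = p"
    using uv in_vertices by (subst Ex_component) auto
  also have "p * (1 - Ex (\<lambda>x. of_bool (?R x))) \<le> p * (1 - keep_bound p (card A) (card B))"
    using keep_bound_le p_nonneg by (intro mult_left_mono) auto
  finally show ?thesis .
qed

end

lemma Ex_card_sided_cover_le: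
  "Ex (\<lambda>x. card (sided_cover (present_edges n x) A B)) \<le> (card A choose 2) * (p * (1 - keep_bound p (card A) (card B)))"
proof -
  let ?P = "{e. e \<subseteq> A \<and> card e = 2}"
  have fin: "finite ?P" by (rule finite_subset[of _ "Pow A"]) (use finite_AB in auto)
  have "real (card (sided_cover (present_edges n x) A B)) =
      (\<Sum>e\<in>?P. of_bool (e \<in> sided_cover (present_edges n x) A B))" for x
  proof -
    have "sided_cover (present_edges n x) A B = {e \<in> ?P. e \<in> sided_cover (present_edges n x) A B}"
      by (auto simp: sided_cover_def)
    then show ?thesis
      using fin by (simp add: Int_def)
  qed
  then have "Ex (\<lambda>x. card (sided_cover (present_edges n x) A B)) =
      (\<Sum>e\<in>?P. Ex (\<lambda>x. of_bool (e \<in> sided_cover (present_edges n x) A B)))"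
    by (simp add: Bochner_Integration.integral_sum)
  also have "\<dots> \<le> (\<Sum>e\<in>?P. p * (1 - keep_bound p (card A) (card B)))"
    by (intro sum_mono) (auto simp: card_2_iff intro!: Ex_in_sided_cover_le)
  also have "\<dots> = (card A choose 2) * (p * (1 - keep_bound p (card A) (card B)))"
    using n_subsets[OF finite_AB(1), of 2] by simp
  finally show ?thesis .
qed

end

section \<open>Asymptotics\<close>

text \<open>Stated for a difference because \<open>l\<close> is only bounded and need not converge.
  The quantity \<open>- k * ln (1 - x)\<close> lies between \<open>k * x\<close> and
  \<open>k * x + 2 * k * x\<^sup>2\<close>, and \<open>k * x\<close> stays bounded.\<close>

lemma one_minus_power_tendsto_exp:
  fixes x l :: "nat \<Rightarrow> real" and k :: "nat \<Rightarrow> nat"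
  assumes x: "x \<longlonglongrightarrow> 0" "\<forall>\<^sub>F n in sequentially. 0 \<le> x n"
    and l: "\<forall>\<^sub>F n in sequentially. 0 \<le> l n \<and> l n \<le> L"
    and kx: "(\<lambda>n. k n * x n - l n) \<longlonglongrightarrow> 0"
  shows "(\<lambda>n. (1 - x n) ^ k n - exp (- l n)) \<longlonglongrightarrow> 0"
proof -
  have exp_diff: "\<bar>exp (- s) - exp (- t)\<bar> \<le> \<bar>s - t\<bar>" if "0 \<le> s" "0 \<le> t" for s t :: real
  proof -
    have "exp (- s) - exp (- t) \<le> t - s" if "0 \<le> s" "s \<le> t" for s t :: real
    proof -
      have "1 - exp (- (t - s)) \<le> t - s"
        using exp_ge_add_one_self[of "- (t - s)"] by linarith
      then have "exp (- s) * (1 - exp (- (t - s))) \<le> 1 * (t - s)"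
        using that by (intro mult_mono) auto
      then show ?thesis by (simp add: algebra_simps flip: exp_add)
    qed
    from this[of s t] this[of t s] show ?thesis
      using that by (cases "s \<le> t") auto
  qed
  \<comment> \<open>1/2 is what the quadratic lower bound on \<open>ln (1 - x n)\<close> requires;
    the next bound yields \<open>k n * x n \<le> L + 1\<close>.\<close>
  have "\<forall>\<^sub>F n in sequentially. \<bar>x n\<bar> < 1 / 2"
    using tendstoD[OF x(1), of "1/2"] by simp
  moreover have "\<forall>\<^sub>F n in sequentially. \<bar>k n * x n - l n\<bar> < 1"
    using tendstoD[OF kx, of 1] by simp
  ultimately have "\<forall>\<^sub>F n in sequentially. norm ((1 - x n) ^ k n - exp (- l n)) \<le>
      \<bar>k n * x n - l n\<bar> + 2 * (L + 1) * x n"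
    using x(2) l
  proof eventually_elim
    case (elim n)
    let ?y = "- (k n * ln (1 - x n))"
    have lo: "- x n - 2 * (x n)\<^sup>2 \<le> ln (1 - x n)"
      using elim by (intro ln_one_minus_pos_lower_bound) auto
    have hi: "ln (1 - x n) \<le> - x n"
      using elim ln_le_minus_one[of "1 - x n"] by simp
    have y: "k n * x n \<le> ?y" "?y \<le> k n * x n + 2 * (k n * x n) * x n"
      using mult_left_mono[OF lo, of "real (k n)"] mult_left_mono[OF hi, of "real (k n)"]
      by (simp_all add: algebra_simps power2_eq_square)
    have "k n * x n \<le> L + 1" using elim by linarith
    then have "2 * (k n * x n) * x n \<le> 2 * (L + 1) * x n"
      using elim by (intro mult_right_mono) auto
    with y have near: "\<bar>?y - l n\<bar> \<le> \<bar>k n * x n - l n\<bar> + 2 * (L + 1) * x n"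
      using elim by linarith
    have power: "(1 - x n) ^ k n = exp (- ?y)"
      using elim by (simp add: exp_of_nat_mult)
    have "0 \<le> k n * x n" using elim by simp
    then have "\<bar>exp (- ?y) - exp (- l n)\<bar> \<le> \<bar>?y - l n\<bar>"
      using y(1) elim by (intro exp_diff) linarith+
    then show ?case
      unfolding real_norm_def power using near by (rule order.trans)
  qed
  moreover have "(\<lambda>n. \<bar>k n * x n - l n\<bar> + 2 * (L + 1) * x n) \<longlonglongrightarrow> 0"
    using tendsto_add[OF tendsto_rabs_zero[OF kx] tendsto_mult_right_zero[OF x(1), of "2 * (L + 1)"]]
    by simp
  ultimately show ?thesis
    by (rule Lim_null_comparison)
qed

text \<open>The first factor of \<open>keep_bound\<close> is close to \<open>exp (- d / 2)\<close>.
  The inner power \<open>y\<close> is close to \<open>exp (- d)\<close>, so the second factor is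
  close to \<open>exp (- (d / 2) * exp (- d))\<close>.\<close>

lemma keep_probability_tendsto:
  fixes p d :: "nat \<Rightarrow> real" and a b :: "nat \<Rightarrow> nat"
  assumes p: "\<And>n. 0 \<le> p n" "p \<longlonglongrightarrow> 0"
    and d: "\<forall>\<^sub>F n in sequentially. 0 \<le> d n \<and> d n \<le> C"
    and b: "(\<lambda>n. b n * (p n)\<^sup>2 - d n / 2) \<longlonglongrightarrow> 0"
    and a: "(\<lambda>n. real (a n - 2) * (p n)\<^sup>2 - d n / 2) \<longlonglongrightarrow> 0"
  shows "(\<lambda>n. keep_bound (p n) (a n) (b n) - exp (- (d n / 2) * (1 + exp (- d n)))) \<longlonglongrightarrow> 0"
proof -
  define y where "y n = (1 - 2 * (p n)\<^sup>2 / (1 + p n)) ^ b n" for n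
  have p2: "(\<lambda>n. (p n)\<^sup>2) \<longlonglongrightarrow> 0"
    using tendsto_power[OF p(2), of 2] by simp
  have bound: "\<forall>\<^sub>F n in sequentially. norm (d n / 2) \<le> C"
    using d by eventually_elim auto
  \<comment> \<open>Since \<open>d\<close> may oscillate, products are treated as null sequence
    times bounded sequence.\<close>
  have null_mult: "(\<lambda>n. f n * g n) \<longlonglongrightarrow> 0"
    if f: "f \<longlonglongrightarrow> 0" and g: "\<forall>\<^sub>F n in sequentially. norm (g n) \<le> K" for f g :: "nat \<Rightarrow> real" and K
  proof (rule Lim_null_comparison)
    show "\<forall>\<^sub>F n in sequentially. norm (f n * g n) \<le> \<bar>f n\<bar> * K"
      using g by eventually_elim (simp add: abs_mult mult_left_mono)
    show "(\<lambda>n. \<bar>f n\<bar> * K) \<longlonglongrightarrow> 0"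
      by (intro tendsto_mult_left_zero tendsto_rabs_zero f)
  qed
  have t1: "(\<lambda>n. (1 - (p n)\<^sup>2) ^ b n - exp (- (d n / 2))) \<longlonglongrightarrow> 0"
    by (rule one_minus_power_tendsto_exp[OF p2 _ _ b, where L = C])
       (use d in \<open>auto elim!: eventually_mono\<close>)
  have "(\<lambda>n. 2 / (1 + p n) * (b n * (p n)\<^sup>2 - d n / 2) + (1 / (1 + p n) - 1) * d n) \<longlonglongrightarrow> 2 / (1 + 0) * 0 + 0"
    by (intro tendsto_intros b p null_mult[where K = C])
       (use d p(2) in \<open>auto elim!: eventually_mono intro!: tendsto_eq_intros\<close>)
  moreover have "2 / (1 + p n) * (b n * (p n)\<^sup>2 - d n / 2) + (1 / (1 + p n) - 1) * d n =
      b n * (2 * (p n)\<^sup>2 / (1 + p n)) - d n" for n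
    by (simp add: algebra_simps diff_divide_distrib)
  ultimately have "(\<lambda>n. b n * (2 * (p n)\<^sup>2 / (1 + p n)) - d n) \<longlonglongrightarrow> 0"
    by simp
  moreover have "(\<lambda>n. 2 * (p n)\<^sup>2 / (1 + p n)) \<longlonglongrightarrow> 0"
    using p2 p(2) by (auto intro!: tendsto_eq_intros)
  ultimately have t2: "(\<lambda>n. y n - exp (- d n)) \<longlonglongrightarrow> 0"
    unfolding y_def using d p(1) by (intro one_minus_power_tendsto_exp[where L = C]) auto
  have "\<forall>\<^sub>F n in sequentially. \<bar>y n - exp (- d n)\<bar> < 1"
    using tendstoD[OF t2, of 1] by simp
  then have y2: "\<forall>\<^sub>F n in sequentially. norm (y n) \<le> 2"
    using d
  proof eventually_elim
    case (elim n)
    have "exp (- d n) \<le> 1" "0 < exp (- d n)" using elim by auto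
    then show ?case using elim by (simp, linarith)
  qed
  have "(\<lambda>n. (real (a n - 2) * (p n)\<^sup>2 - d n / 2) * y n + (y n - exp (- d n)) * (d n / 2)) \<longlonglongrightarrow> 0 + 0"
    by (intro tendsto_add null_mult[OF a y2] null_mult[OF t2 bound])
  then have az: "(\<lambda>n. real (a n - 2) * ((p n)\<^sup>2 * y n) - d n / 2 * exp (- d n)) \<longlonglongrightarrow> 0"
    by (simp add: algebra_simps)
  have small: "\<forall>\<^sub>F n in sequentially. p n < 1"
    using order_tendstoD(2)[OF p(2), of 1] by simp
  have "\<forall>\<^sub>F n in sequentially. 0 \<le> (p n)\<^sup>2 * y n"
    using small
  proof eventually_elim
    case (elim n)
    have "(p n)\<^sup>2 \<le> p n" using elim p(1)[of n] by (simp add: power2_eq_square mult_left_le)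
    then have "0 \<le> 1 - 2 * (p n)\<^sup>2 / (1 + p n)"
      using elim p(1)[of n] by (auto simp: field_simps)
    then show ?case unfolding y_def by simp
  qed
  moreover have "\<forall>\<^sub>F n in sequentially. 0 \<le> d n / 2 * exp (- d n) \<and> d n / 2 * exp (- d n) \<le> C"
    using d
  proof eventually_elim
    case (elim n)
    then have "d n / 2 * exp (- d n) \<le> C * 1" by (intro mult_mono) auto
    then show ?case using elim by simp
  qed
  ultimately have t3: "(\<lambda>n. (1 - (p n)\<^sup>2 * y n) ^ (a n - 2) - exp (- (d n / 2 * exp (- d n)))) \<longlonglongrightarrow> 0"
    using az null_mult[OF p2 y2] by (intro one_minus_power_tendsto_exp[where L = C]) auto
  have e1: "\<forall>\<^sub>F n in sequentially. norm (exp (- (d n / 2))) \<le> 1"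
    using d by eventually_elim auto
  have t3b: "\<forall>\<^sub>F n in sequentially. norm ((1 - (p n)\<^sup>2 * y n) ^ (a n - 2)) \<le> 2"
    using d tendstoD[OF t3 zero_less_one]
  proof eventually_elim
    case (elim n)
    have "exp (- (d n / 2 * exp (- d n))) \<le> 1" "0 < exp (- (d n / 2 * exp (- d n)))" using elim by auto
    then show ?case using elim(2) unfolding dist_real_def real_norm_def by linarith
  qed
  \<comment> \<open>Difference of products:
    \<open>X * Y - X' * Y' = (X - X') * Y + (Y - Y') * X'\<close>.\<close>
  have "(\<lambda>n. ((1 - (p n)\<^sup>2) ^ b n - exp (- (d n / 2))) * (1 - (p n)\<^sup>2 * y n) ^ (a n - 2) +
      ((1 - (p n)\<^sup>2 * y n) ^ (a n - 2) - exp (- (d n / 2 * exp (- d n)))) * exp (- (d n / 2))) \<longlonglongrightarrow> 0 + 0"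
    by (intro tendsto_add null_mult[OF t1 t3b] null_mult[OF t3 e1])
  then show ?thesis
    unfolding keep_bound_def y_def[symmetric] by (simp add: algebra_simps add_divide_distrib flip: exp_add)
qed

section \<open>Expectation and concentration of the cover number\<close>

lemma gnp_eq_map_coins:
  assumes "bernoulli_product (potential_edges n) p"
  shows "gnp n p = map_pmf (present_edges n) (bernoulli_product.coins p (potential_edges n))"
  unfolding gnp_def bernoulli_product.coins_def[OF assms] present_edges_def ..

lemma triangle_cover_number_Lipschitz:
  "\<bar>real (triangle_cover_number (present_edges n (x(e := True)))) -
    real (triangle_cover_number (present_edges n (x(e := False))))\<bar> \<le> 1"
proof (cases "e \<in> potential_edges n")
  case True
  let ?E = "present_edges n (x(e := False))"
  have "present_edges n (x(e := True)) = insert e ?E" "e \<notin> ?E"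
    using True by (auto simp: present_edges_def)
  then show ?thesis
    using triangle_cover_number_insert[of ?E e] finite_present_edges by simp
next
  case False
  then have "present_edges n (x(e := True)) = present_edges n (x(e := False))"
    by (auto simp: present_edges_def)
  then show ?thesis by simp
qed

context gnp_bipartition
begin

abbreviation tau :: "(nat set \<Rightarrow> bool) \<Rightarrow> real" where
  "tau x \<equiv> real (triangle_cover_number (present_edges n x))"

lemma Ex_tau_le:
  "Ex tau \<le> p * ((card A choose 2) * (1 - keep_bound p (card A) (card B)) +
     (card B choose 2) * (1 - keep_bound p (card B) (card A)))"
proof -
  interpret swapped: gnp_bipartition n p B A
    using union_eq disj by unfold_locales auto
  let ?SA = "\<lambda>x. sided_cover (present_edges n x) A B"
  let ?SB = "\<lambda>x. sided_cover (present_edges n x) B A"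
  have "tau x \<le> real (card (?SA x)) + real (card (?SB x))" for x
  proof -
    have "\<Union> (present_edges n x) \<subseteq> A \<union> B"
      unfolding present_edges_def potential_edges_def union_eq by auto
    moreover have "?SA x \<union> ?SB x \<subseteq> present_edges n x"
      by (auto simp: sided_cover_def)
    ultimately have "triangle_cover_number (present_edges n x) \<le> card (?SA x \<union> ?SB x)"
      by (intro triangle_cover_number_le sided_covers_hit_triangle)
         (auto intro: finite_subset finite_present_edges)
    also have "\<dots> \<le> card (?SA x) + card (?SB x)" by (rule card_Un_le)
    finally show ?thesis by simp
  qed
  then have "Ex tau \<le> Ex (\<lambda>x. real (card (?SA x)) + real (card (?SB x)))"
    by (intro integral_mono) auto
  also have "\<dots> = Ex (\<lambda>x. real (card (?SA x))) + Ex (\<lambda>x. real (card (?SB x)))"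
    by (rule Bochner_Integration.integral_add) auto
  also have "\<dots> \<le> (card A choose 2) * (p * (1 - keep_bound p (card A) (card B))) +
      (card B choose 2) * (p * (1 - keep_bound p (card B) (card A)))"
    by (intro add_mono Ex_card_sided_cover_le swapped.Ex_card_sided_cover_le)
  finally show ?thesis by (simp add: algebra_simps)
qed

text \<open>Chebyshev's inequality: \<open>tau x \<ge> M\<close> forces a deviation of at least
  \<open>s\<close>, and the variance is at most the number of potential edges.\<close>

lemma prob_tau_less:
  assumes "0 < s" "Ex tau + s \<le> M"
  shows "1 - (n choose 2) / s\<^sup>2 \<le> measure_pmf.prob (gnp n p) {E. real (triangle_cover_number E) < M}"
proof -
  have "measure_pmf.prob (coins (potential_edges n)) {x. M \<le> tau x} \<le>
      measure_pmf.prob (coins (potential_edges n)) {x. s \<le> \<bar>tau x - Ex tau\<bar>}"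
    using assms by (intro measure_pmf.finite_measure_mono) auto
  also have "\<dots> \<le> measure_pmf.variance (coins (potential_edges n)) tau / s\<^sup>2"
    using measure_pmf.Chebyshev_inequality[of tau "coins (potential_edges n)" s] assms(1) by simp
  also have "\<dots> \<le> (n choose 2) / s\<^sup>2"
    using Efron_Stein_Lipschitz[where f = tau, OF finite_potential_edges triangle_cover_number_Lipschitz]
    by (intro divide_right_mono) (auto simp: card_potential_edges)
  finally have "measure_pmf.prob (coins (potential_edges n)) {x. M \<le> tau x} \<le> (n choose 2) / s\<^sup>2" .
  moreover have "{x. M \<le> tau x} = UNIV - {x. tau x < M}" by auto
  then have "measure_pmf.prob (coins (potential_edges n)) {x. M \<le> tau x} =
      1 - measure_pmf.prob (coins (potential_edges n)) {x. tau x < M}"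
    using measure_pmf.prob_compl[of "{x. tau x < M}" "coins (potential_edges n)"] by simp
  moreover have "measure_pmf.prob (gnp n p) {E. real (triangle_cover_number E) < M} =
      measure_pmf.prob (coins (potential_edges n)) {x. tau x < M}"
    unfolding gnp_eq_map_coins[OF bernoulli_product_axioms] measure_map_pmf by (simp add: vimage_def)
  ultimately show ?thesis by linarith
qed

end

section \<open>Sizes of the two halves\<close>

lemma real_choose_two: "real (n choose 2) = real n * (real n - 1) / 2"
proof -
  have "even (n * (n - 1))" by (cases n) auto
  then have "real (n choose 2) = real (n * (n - 1)) / 2"
    unfolding choose_two by (simp add: real_of_nat_div)
  then show ?thesis by (cases n) (auto simp: algebra_simps)
qed

text \<open>The source of the factor 1/2 in \<open>psi\<close>; it holds for every \<open>n\<close>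
  without an error term.\<close>

lemma choose_two_halves_le:
  "real (n div 2 choose 2) + real ((n - n div 2) choose 2) \<le> real (n choose 2) / 2"
proof (cases "even n")
  case True
  then obtain k where "n = 2 * k" by blast
  then show ?thesis
    unfolding real_choose_two by (simp add: field_simps)
next
  case False
  then obtain k where "n = 2 * k + 1" using oddE by blast
  then show ?thesis
    unfolding real_choose_two by (simp add: field_simps)
qed

text \<open>The tolerance 3 lets one lemma serve both halves and both halves minus 2, as they occur
  in \<open>keep_bound\<close>.\<close>

lemma halves_degree_tendsto:
  fixes p d :: "nat \<Rightarrow> real" and k :: "nat \<Rightarrow> nat"
  assumes "p \<longlonglongrightarrow> 0" "\<And>n. d n = (real n - 2) * (p n)\<^sup>2"
    and "\<forall>\<^sub>F n in sequentially. \<bar>real (k n) - n / 2\<bar> \<le> 3"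
  shows "(\<lambda>n. real (k n) * (p n)\<^sup>2 - d n / 2) \<longlonglongrightarrow> 0"
proof (rule Lim_null_comparison)
  show "\<forall>\<^sub>F n in sequentially. norm (real (k n) * (p n)\<^sup>2 - d n / 2) \<le> 4 * (p n)\<^sup>2"
    using assms(3)
  proof eventually_elim
    case (elim n)
    have "real (k n) * (p n)\<^sup>2 - d n / 2 = (real (k n) - n / 2 + 1) * (p n)\<^sup>2"
      unfolding assms(2) by (simp add: field_simps)
    moreover have "\<bar>real (k n) - n / 2 + 1\<bar> \<le> 4" using elim by linarith
    ultimately show ?case by (simp add: abs_mult mult_right_mono)
  qed
  show "(\<lambda>n. 4 * (p n)\<^sup>2) \<longlonglongrightarrow> 0"
    by (rule tendsto_eq_intros assms(1) refl | simp)+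
qed

theorem theorem1p5:
  fixes p m d :: "nat \<Rightarrow> real" and c C \<epsilon> :: real
  assumes p_prob: "\<And>n. 0 \<le> p n \<and> p n \<le> 1"
    and m_eq: "\<And>n. m n = real (n choose 2) * p n"
    and d_eq: "\<And>n. d n = (real n - 2) * (p n)\<^sup>2"
    and "0 < c" and "c \<le> C"
    and d_bounds: "eventually (\<lambda>n. c \<le> d n \<and> d n \<le> C) sequentially"
    and "0 < \<epsilon>"
  shows "(\<lambda>n. measure_pmf.prob (gnp n (p n))
            {E. real (triangle_cover_number E) < (1 + \<epsilon>) * psi (d n) * m n})
           \<longlonglongrightarrow> 1"
proof -
  let ?a = "\<lambda>n :: nat. n div 2" and ?b = "\<lambda>n :: nat. n - n div 2"
  let ?e = "\<lambda>n. exp (- (d n / 2) * (1 + exp (- d n)))"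
  let ?P = "\<lambda>n. measure_pmf.prob (gnp n (p n))
      {E. real (triangle_cover_number E) < (1 + \<epsilon>) * psi (d n) * m n}"
  \<comment> \<open>A lower bound for \<open>psi (d n)\<close> uniform in \<open>n\<close>: the
    exponent is at least \<open>d n / 2\<close>, hence at least \<open>c / 2\<close>.\<close>
  define psi0 where "psi0 = (1 - exp (- (c / 2))) / 2"
  have psi0: "0 < psi0" using \<open>0 < c\<close> unfolding psi0_def by simp
  have d': "\<forall>\<^sub>F n in sequentially. 0 \<le> d n \<and> d n \<le> C"
    using d_bounds \<open>0 < c\<close> by (auto elim!: eventually_mono)
  have "(\<lambda>n. (p n)\<^sup>2) \<longlonglongrightarrow> 0"
  proof (rule Lim_null_comparison)
    show "\<forall>\<^sub>F n in sequentially. norm ((p n)\<^sup>2) \<le> 2 * C * (1 / n)"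
      using d' eventually_ge_at_top[of 4]
    proof eventually_elim
      case (elim n)
      have "real n / 2 * (p n)\<^sup>2 \<le> (real n - 2) * (p n)\<^sup>2"
        using elim by (intro mult_right_mono) auto
      then show ?case using elim by (simp add: d_eq field_simps)
    qed
    show "(\<lambda>n. 2 * C * (1 / real n)) \<longlonglongrightarrow> 0"
      by (intro tendsto_mult_right_zero lim_1_over_n)
  qed
  then have "(\<lambda>n. sqrt ((p n)\<^sup>2)) \<longlonglongrightarrow> sqrt 0"
    by (rule tendsto_real_sqrt)
  then have p0: "p \<longlonglongrightarrow> 0"
    using p_prob by simp
  have large: "\<forall>\<^sub>F n :: nat in sequentially. 4 \<le> n" by (rule eventually_ge_at_top)
  have halves: "(\<lambda>n. real (k n) * (p n)\<^sup>2 - d n / 2) \<longlonglongrightarrow> 0"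
    if "\<And>n. 4 \<le> n \<Longrightarrow> n \<le> 2 * k n + 6 \<and> 2 * k n \<le> n + 6" for k
    by (rule halves_degree_tendsto[OF p0 d_eq], rule eventually_mono[OF large])
       (use that in \<open>force simp: abs_le_iff field_simps\<close>)
  have keepA: "(\<lambda>n. keep_bound (p n) (?a n) (?b n) - ?e n) \<longlonglongrightarrow> 0"
    by (rule keep_probability_tendsto[OF _ p0 d' halves halves]) (simp add: p_prob, presburger+)
  have keepB: "(\<lambda>n. keep_bound (p n) (?b n) (?a n) - ?e n) \<longlonglongrightarrow> 0"
    by (rule keep_probability_tendsto[OF _ p0 d' halves halves]) (simp add: p_prob, presburger+)
  \<comment> \<open>\<open>\<eta>\<close> serves twice: as the error in \<open>keep_bound\<close>,
    costing \<open>\<eta> / 2 * m n\<close>, and as the Chebyshev deviation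
    \<open>\<eta> * m n\<close>. Together these are 3/4 of
    \<open>\<epsilon> * psi0 * m n\<close>.\<close>
  define \<eta> where "\<eta> = \<epsilon> * psi0 / 2"
  have \<eta>: "0 < \<eta>" unfolding \<eta>_def using psi0 \<open>0 < \<epsilon>\<close> by simp
  have "\<forall>\<^sub>F n in sequentially. 1 - 2 / (\<eta>\<^sup>2 * c) * (1 / n) \<le> ?P n"
    using d_bounds large tendstoD[OF keepA \<eta>] tendstoD[OF keepB \<eta>]
  proof eventually_elim
    case (elim n)
    interpret gnp_bipartition n "p n" "{1..n div 2}" "{n div 2<..n}"
      using p_prob by unfold_locales (auto simp: finite_potential_edges)
    let ?kA = "keep_bound (p n) (?a n) (?b n)" and ?kB = "keep_bound (p n) (?b n) (?a n)"
    have psi_eq: "2 * psi (d n) = 1 - ?e n" unfolding psi_def by simp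
    have keep: "1 - k \<le> 2 * (s + \<eta> / 2)" if "dist (k - e) 0 < \<eta>" "2 * s = 1 - e" for k s e
      using that unfolding dist_real_def by (simp add: distrib_left)
    note kA = keep[OF elim(3) psi_eq] and kB = keep[OF elim(4) psi_eq]
    have "d n * exp (- d n) \<ge> 0" using elim \<open>0 < c\<close> by simp
    then have "exp (- (d n / 2) * (1 + exp (- d n))) \<le> exp (- (c / 2))"
      using elim(1) by (simp add: algebra_simps add_divide_distrib)
    then have psi: "psi0 \<le> psi (d n)"
      unfolding psi0_def psi_def by simp
    have "p n \<noteq> 0" using elim(1) \<open>0 < c\<close> unfolding d_eq by auto
    then have pn: "0 < p n" using p_prob[of n] by simp
    have m: "0 < m n" unfolding m_eq using pn elim(2) by simp
    have "Ex tau \<le> p n * (real (?a n choose 2) * (1 - ?kA) + real (?b n choose 2) * (1 - ?kB))"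
      using Ex_tau_le by simp
    also have "\<dots> \<le> p n * (real (?a n choose 2) * (2 * (psi (d n) + \<eta> / 2)) +
        real (?b n choose 2) * (2 * (psi (d n) + \<eta> / 2)))"
      using kA kB pn by (intro mult_left_mono add_mono) auto
    also have "\<dots> = p n * (2 * (psi (d n) + \<eta> / 2)) * (real (?a n choose 2) + real (?b n choose 2))"
      by (simp add: algebra_simps)
    also have "\<dots> \<le> p n * (2 * (psi (d n) + \<eta> / 2)) * (real (n choose 2) / 2)"
      using pn psi psi0 \<eta> by (intro mult_left_mono choose_two_halves_le) auto
    also have "\<dots> = (psi (d n) + \<eta> / 2) * m n"
      unfolding m_eq by (simp add: algebra_simps)
    finally have "Ex tau \<le> (psi (d n) + \<eta> / 2) * m n" .
    moreover have "(psi (d n) + \<eta> / 2) * m n + \<eta> * m n \<le> (1 + \<epsilon>) * psi (d n) * m n"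
    proof -
      have "\<eta> * (3 / 2) \<le> \<epsilon> * psi (d n)"
        unfolding \<eta>_def using mult_left_mono[OF psi, of \<epsilon>] mult_pos_pos[OF \<open>0 < \<epsilon>\<close> psi0] \<open>0 < \<epsilon>\<close>
        by linarith
      then have "(psi (d n) + \<eta> / 2 + \<eta>) * m n \<le> ((1 + \<epsilon>) * psi (d n)) * m n"
        using m by (intro mult_right_mono) (auto simp: algebra_simps)
      then show ?thesis by (simp add: algebra_simps)
    qed
    ultimately have "1 - (n choose 2) / (\<eta> * m n)\<^sup>2 \<le> ?P n"
      using m \<eta> by (intro prob_tau_less) auto
    \<comment> \<open>The ratio is the reciprocal of
      \<open>\<eta>\<^sup>2 * ((n choose 2) * (p n)\<^sup>2)\<close>, and \<open>d n \<ge> c\<close>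
      makes \<open>(n choose 2) * (p n)\<^sup>2\<close> at least \<open>n * c / 2\<close>.\<close>
    moreover have "(n choose 2) / (\<eta> * m n)\<^sup>2 \<le> 2 / (\<eta>\<^sup>2 * c) * (1 / n)"
    proof -
      let ?N = "real (n choose 2)"
      have N: "0 < ?N" using m pn unfolding m_eq by (simp add: zero_less_mult_iff)
      have "c \<le> (real n - 2) * (p n)\<^sup>2" using elim(1) unfolding d_eq by simp
      also have "\<dots> \<le> (real n - 1) * (p n)\<^sup>2" by (intro mult_right_mono) auto
      finally have "c \<le> (real n - 1) * (p n)\<^sup>2" .
      then have "real n / 2 * c \<le> real n / 2 * ((real n - 1) * (p n)\<^sup>2)"
        by (intro mult_left_mono) auto
      also have "\<dots> = ?N * (p n)\<^sup>2" unfolding real_choose_two by simp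
      finally have Np: "n * c / 2 \<le> ?N * (p n)\<^sup>2" by simp
      have "?N / (\<eta> * m n)\<^sup>2 = 1 / (\<eta>\<^sup>2 * (?N * (p n)\<^sup>2))"
        using N unfolding m_eq by (simp add: power_mult_distrib power2_eq_square)
      also have "\<dots> \<le> 1 / (\<eta>\<^sup>2 * (n * c / 2))"
        using Np \<eta> \<open>0 < c\<close> elim(2) by (intro frac_le mult_left_mono) auto
      finally show ?thesis by (simp add: mult_ac)
    qed
    ultimately show ?case by simp
  qed
  then show ?thesis
  proof (rule tendsto_sandwich)
    show "\<forall>\<^sub>F n in sequentially. ?P n \<le> 1" by simp
    have "(\<lambda>n. 1 - 2 / (\<eta>\<^sup>2 * c) * (1 / real n)) \<longlonglongrightarrow> 1 - 0"
      by (intro tendsto_diff tendsto_const tendsto_mult_right_zero lim_1_over_n)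
    then show "(\<lambda>n. 1 - 2 / (\<eta>\<^sup>2 * c) * (1 / real n)) \<longlonglongrightarrow> 1" by simp
  qed simp
qed

end
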